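(* Let $(\Omega,\mathcal F,\mathbb P)$ be a probability space, let $\xi$ be a random element in some ordered metric space $(\mathcal X,d,\preceq)$ and let $Z$ be a random variable. Then $Z$ is $\mathscr L(\xi)$-measurable if and only if there exists an increasing Borel measurable function $f:\mathcal X\to\mathbb R$ such that $Z=f(\xi)$. In particular, for any integrable random variable $Y$, there exists an increasing Borel measurable function $f:\mathcal X\to\mathbb R$ such that $\mathbb E(Y\mid\mathscr L(\xi))=f(\xi)$ almost surely.
   Context: An ordered metric space $(\mathcal X,d,\preceq)$ is a nonempty set $\mathcal X$ equipped with a metric $d$ and a partial order $\preceq$. $\mathcal B(\mathcal X)$ is the Borel $\sigma$-algebra. A set $B\subseteq\mathcal X$ is an upper set if $x\in B$ and $x\preceq y$ imply $y\in B$; $\mathscr U$ is the family of all upper sets. A random element in $\mathcal X$ is an $\mathcal F$-$\mathcal B(\mathcal X)$-measurable map $\xi:\Omega\to\mathcal X$; random variables are real-valued. The $\sigma$-lattice generated by $\xi$ is $\mathscr L(\xi)=\{\xi^{-1}(B)\mid B\in\mathcal B(\mathcal X)\cap\mathscr U\}$. A function $f:\mathcal X\to\mathbb R$ is increasing (isotonic) if $x\preceq y$ implies $f(x)\le f(y)$. A $\sigma$-lattice $\mathcal A\subseteq\mathcal F$ is a family containing $\emptyset,\Omega$ and closed under countable unions and intersections. A random variable $X$ is $\mathcal A$-measurable if $\{X>a\}\in\mathcal A$ for all $a\in\mathbb R$. For an integrable random variable $Y$, $\mathbb E(Y\mid\mathcal A)$ is the (almost surely unique, always existing) integrable $\mathcal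 A$-measurable random variable $X$ with $\mathbb E(Y\mathbf 1_A)\le\mathbb E(X\mathbf 1_A)$ for all $A\in\mathcal A$ and $\mathbb E(X\mathbf 1_B)=\mathbb E(Y\mathbf 1_B)$ for all $B\in\sigma(X)$.
   Formalization: f takes values in [-∞,∞] instead of ℝ: for ξ=-1/(n+1), Z=Y=n with geometric weights, a real increasing f on ℝ would need f(0)≥n for all n. The second part is stated for every real-valued version of E(Y|L(ξ)), whose existence is not asserted. *)

theory Defs
  imports "HOL-Probability.Probability"
begin

text \<open>
  An ordered metric space is a type of class \<open>metric_space\<close> and class \<open>order\<close>. Neither class
  relates the order to the metric. Increasing functions are those with \<open>mono\<close>.
\<close>

definition upper_set :: "'x::order set \<Rightarrow> bool" where
  "upper_set B \<longleftrightarrow> (\<forall>x\<in>B. \<forall>y. x \<le> y \<longrightarrow> y \<in> B)"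

definition sigma_lattice :: "'w measure \<Rightarrow> 'w set set \<Rightarrow> bool" where
  "sigma_lattice M \<A> \<longleftrightarrow>
     \<A> \<subseteq> sets M \<and> {} \<in> \<A> \<and> space M \<in> \<A> \<and>
     (\<forall>A :: nat \<Rightarrow> 'w set. range A \<subseteq> \<A> \<longrightarrow> (\<Union>n. A n) \<in> \<A> \<and> (\<Inter>n. A n) \<in> \<A>)"

definition generated_lattice ::
    "'w measure \<Rightarrow> ('w \<Rightarrow> 'x::{metric_space, order}) \<Rightarrow> 'w set set" where
  "generated_lattice M \<xi> = {\<xi> -` B \<inter> space M | B. B \<in> sets borel \<and> upper_set B}"

definition lattice_measurable :: "'w measure \<Rightarrow> 'w set set \<Rightarrow> ('w \<Rightarrow> real) \<Rightarrow> bool" where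
  "lattice_measurable M \<A> X \<longleftrightarrow> (\<forall>a. {\<omega> \<in> space M. X \<omega> > a} \<in> \<A>)"

text \<open>
  \<open>is_lattice_cond_exp M \<A> Y X\<close>: the random variable \<open>X\<close> is a version of the conditional
  expectation of \<open>Y\<close> given the sigma-lattice \<open>\<A>\<close>. The family \<open>sets (vimage_algebra (space M) X borel)\<close>
  is the sigma-algebra generated by \<open>X\<close>.
\<close>

definition is_lattice_cond_exp ::
    "'w measure \<Rightarrow> 'w set set \<Rightarrow> ('w \<Rightarrow> real) \<Rightarrow> ('w \<Rightarrow> real) \<Rightarrow> bool" where
  "is_lattice_cond_exp M \<A> Y X \<longleftrightarrow>
     integrable M X \<and> lattice_measurable M \<A> X \<and>
     (\<forall>A\<in>\<A>. (\<integral>\<omega>. Y \<omega> * indicator A \<omega> \<partial>M) \<le> (\<integral>\<omega>. X \<omega> * indicator A \<omega> \<partial>M)) \<and>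
     (\<forall>B\<in>sets (vimage_algebra (space M) X borel).
        (\<integral>\<omega>. X \<omega> * indicator B \<omega> \<partial>M) = (\<integral>\<omega>. Y \<omega> * indicator B \<omega> \<partial>M))"

text \<open>
  Pitfall: an increasing \<open>f\<close> with \<open>Z = f(\<xi>)\<close> may be forced to take infinite values at points
  outside the range of \<open>\<xi>\<close>, even if \<open>Z\<close> is integrable. If \<open>\<xi>\<close> takes the values
  \<open>-1/(n+1)\<close> in the real line, each with positive probability, and \<open>Z = n\<close> where
  \<open>\<xi> = -1/(n+1)\<close>, then \<open>f 0 \<ge> n\<close> for every \<open>n\<close>. So increasing functions below have values
  in \<open>ereal\<close>, while random variables are real-valued. If \<open>Z = f(\<xi>)\<close>, then \<open>f\<close> is finite at
  every point that lies, in the order, between two values of \<open>\<xi>\<close>.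
\<close>

lemma sigma_lattice_generated_lattice:
  assumes "\<xi> \<in> measurable M borel"
  shows "sigma_lattice M (generated_lattice M \<xi>)"
  unfolding sigma_lattice_def
proof (intro conjI allI impI)
  show "generated_lattice M \<xi> \<subseteq> sets M"
    using assms by (auto simp: generated_lattice_def)
  show "{} \<in> generated_lattice M \<xi>"
    unfolding generated_lattice_def by (rule CollectI, rule exI[of _ "{}"]) (auto simp: upper_set_def)
  show "space M \<in> generated_lattice M \<xi>"
    unfolding generated_lattice_def by (rule CollectI, rule exI[of _ UNIV]) (auto simp: upper_set_def)
next
  fix A :: "nat \<Rightarrow> _" assume "range A \<subseteq> generated_lattice M \<xi>"
  then have "\<forall>n. \<exists>B. A n = \<xi> -` B \<inter> space M \<and> B \<in> sets borel \<and> upper_set B"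
    unfolding generated_lattice_def by blast
  then obtain B where B: "\<And>n. A n = \<xi> -` B n \<inter> space M" "\<And>n. B n \<in> sets borel" "\<And>n. upper_set (B n)"
    by metis
  have *: "(\<Union>n. A n) = \<xi> -` (\<Union>n. B n) \<inter> space M" "(\<Inter>n. A n) = \<xi> -` (\<Inter>n. B n) \<inter> space M"
    using B(1) by auto
  have m: "(\<Union>n. B n) \<in> sets borel" "(\<Inter>n. B n) \<in> sets borel"
    using B(2) by (auto intro!: sets.countable_INT)
  have u: "upper_set (\<Union>n. B n)" "upper_set (\<Inter>n. B n)"
    using B(3) unfolding upper_set_def by blast+
  show "(\<Union>n. A n) \<in> generated_lattice M \<xi>" "(\<Inter>n. A n) \<in> generated_lattice M \<xi>"
    unfolding generated_lattice_def using * m u by blast+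
qed

end

theory Submission
  imports Defs
begin

text \<open>
  If \<open>Z\<close> is measurable with respect to the generated lattice, then every \<open>{Z > q}\<close> with rational \<open>q\<close>
  is the preimage under \<open>\<xi>\<close> of a Borel upper set \<open>B q\<close>. The function \<open>f x = sup {q. x \<in> B q}\<close> is
  increasing because each \<open>B q\<close> is an upper set, and \<open>f (\<xi> \<omega>) = sup {q. q < Z \<omega>} = Z \<omega>\<close>
  by density of the rationals.
\<close>

lemma lattice_measurable_factorization:
  fixes M :: "'w measure" and \<xi> :: "'w \<Rightarrow> 'x::{metric_space, order}" and Z :: "'w \<Rightarrow> real"
  assumes "lattice_measurable M (generated_lattice M \<xi>) Z"
  shows "\<exists>f :: 'x \<Rightarrow> ereal. mono f \<and> f \<in> borel_measurable borel \<and>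
           (\<forall>\<omega>\<in>space M. ereal (Z \<omega>) = f (\<xi> \<omega>))"
proof -
  have "\<forall>q::rat. \<exists>B. {\<omega> \<in> space M. Z \<omega> > of_rat q} = \<xi> -` B \<inter> space M \<and> B \<in> sets borel \<and> upper_set B"
    using assms unfolding lattice_measurable_def generated_lattice_def by blast
  then obtain B :: "rat \<Rightarrow> 'x set"
    where pre: "\<And>q. {\<omega> \<in> space M. Z \<omega> > of_rat q} = \<xi> -` B q \<inter> space M"
      and borel [measurable]: "\<And>q. B q \<in> sets borel"
      and upper: "\<And>q. upper_set (B q)"
    by metis
  \<comment> \<open>The default \<open>-\<infinity>\<close> is the least value, so a rational
    \<open>q\<close> with \<open>x \<notin> B q\<close> adds nothing to the supremum. Off the range
    of \<open>\<xi>\<close>, a point may lie in no \<open>B q\<close> or in all of them; then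
    \<open>f\<close> is \<open>-\<infinity>\<close> or \<open>\<infinity>\<close>.\<close>
  define f :: "'x \<Rightarrow> ereal" where
    "f x = (SUP q. if x \<in> B q then ereal (of_rat q) else -\<infinity>)" for x
  have "mono f"
    unfolding f_def
    by (intro monoI SUP_mono') (use upper in \<open>auto simp: upper_set_def\<close>)
  \<comment> \<open>The index type \<open>rat\<close> is countable, so this is a countable supremum
    of Borel functions.\<close>
  moreover have "f \<in> borel_measurable borel"
    unfolding f_def by measurable
  moreover have "ereal (Z \<omega>) = f (\<xi> \<omega>)" if "\<omega> \<in> space M" for \<omega>
  proof -
    have mem: "\<xi> \<omega> \<in> B q \<longleftrightarrow> of_rat q < Z \<omega>" for q
      using pre[of q] that by blast
    show ?thesis
    proof (rule antisym)
      show "f (\<xi> \<omega>) \<le> ereal (Z \<omega>)"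
        unfolding f_def by (intro SUP_least) (auto simp: mem)
      show "ereal (Z \<omega>) \<le> f (\<xi> \<omega>)"
      \<comment> \<open>It suffices to compare with real upper bounds \<open>z\<close> of
        \<open>f (\<xi> \<omega>)\<close>: if \<open>z < Z \<omega>\<close>, a rational strictly
        between them is a term of the supremum exceeding \<open>z\<close>.\<close>
      proof (rule ereal_le_real)
        fix z :: real
        assume *: "f (\<xi> \<omega>) \<le> ereal z"
        show "ereal (Z \<omega>) \<le> ereal z"
        proof (rule ccontr)
          assume "\<not> ?thesis"
          then obtain q where q: "z < of_rat q" "of_rat q < Z \<omega>"
            using of_rat_dense[of z "Z \<omega>"] by auto
          have "ereal (of_rat q) \<le> f (\<xi> \<omega>)"
            unfolding f_def by (rule SUP_upper2[of q]) (use q in \<open>auto simp: mem\<close>)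
          also note *
          finally show False
            using q by simp
        qed
      qed
    qed
  qed
  ultimately show ?thesis
    by blast
qed

text \<open>Strict superlevel sets of an increasing Borel function are Borel upper sets, and their
  preimages under \<open>\<xi>\<close> are the sets \<open>{Z > a}\<close>.\<close>

lemma lattice_measurable_mono_comp:
  fixes f :: "'x::{metric_space, order} \<Rightarrow> ereal"
  assumes "mono f" and [measurable]: "f \<in> borel_measurable borel"
    and eq: "\<And>\<omega>. \<omega> \<in> space M \<Longrightarrow> ereal (Z \<omega>) = f (\<xi> \<omega>)"
  shows "lattice_measurable M (generated_lattice M \<xi>) Z"
  unfolding lattice_measurable_def generated_lattice_def
proof (intro allI CollectI exI conjI)
  fix a :: real
  show "{\<omega> \<in> space M. a < Z \<omega>} = \<xi> -` {x. ereal a < f x} \<inter> space M"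
    using eq by (auto simp flip: less_ereal.simps(1))
  show "{x. ereal a < f x} \<in> sets borel"
    by measurable
  show "upper_set {x. ereal a < f x}"
    using \<open>mono f\<close> by (auto simp: upper_set_def dest: monoD less_le_trans)
qed

theorem proposition3p2:
  fixes M :: "'w measure"
    and \<xi> :: "'w \<Rightarrow> 'x::{metric_space, order}"
    and Z :: "'w \<Rightarrow> real"
  assumes "prob_space M"
    and "\<xi> \<in> measurable M borel"
    and "Z \<in> borel_measurable M"
  shows "(lattice_measurable M (generated_lattice M \<xi>) Z \<longleftrightarrow>
           (\<exists>f :: 'x \<Rightarrow> ereal. mono f \<and> f \<in> borel_measurable borel \<and>
              (\<forall>\<omega>\<in>space M. ereal (Z \<omega>) = f (\<xi> \<omega>)))) \<and>
         (\<forall>Y X :: 'w \<Rightarrow> real. integrable M Y \<longrightarrow>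
           is_lattice_cond_exp M (generated_lattice M \<xi>) Y X \<longrightarrow>
           (\<exists>f :: 'x \<Rightarrow> ereal. mono f \<and> f \<in> borel_measurable borel \<and>
              (AE \<omega> in M. ereal (X \<omega>) = f (\<xi> \<omega>))))"
proof (intro conjI allI impI)
  show "lattice_measurable M (generated_lattice M \<xi>) Z \<longleftrightarrow>
          (\<exists>f :: 'x \<Rightarrow> ereal. mono f \<and> f \<in> borel_measurable borel \<and>
             (\<forall>\<omega>\<in>space M. ereal (Z \<omega>) = f (\<xi> \<omega>)))"
    using lattice_measurable_factorization lattice_measurable_mono_comp by metis
next
  fix Y X :: "'w \<Rightarrow> real"
  assume "is_lattice_cond_exp M (generated_lattice M \<xi>) Y X"
  \<comment> \<open>Lattice measurability is part of being a version, so \<open>X\<close> itself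
    factors through \<open>\<xi>\<close> on all of \<open>space M\<close>, hence almost
    everywhere.\<close>
  then have "lattice_measurable M (generated_lattice M \<xi>) X"
    by (simp add: is_lattice_cond_exp_def)
  from lattice_measurable_factorization[OF this]
  show "\<exists>f :: 'x \<Rightarrow> ereal. mono f \<and> f \<in> borel_measurable borel \<and>
          (AE \<omega> in M. ereal (X \<omega>) = f (\<xi> \<omega>))"
    by (blast intro: AE_I2)
qed

end
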